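(* Assume $\rho<1$ and that there exist $\mu_i>0$, $i\in\mathcal I$, such that $\mu_{ij}=\mu_i$ for all $(ij)\in\mathcal E$. Then the system is locally stable (i.e., $A_u$ is stable).
   Context: Model. Customer types $i\in\mathcal I$, $|\mathcal I|=I$; server pools $j\in\mathcal J$, $|\mathcal J|=J$ (finite). Parameters: $\lambda_i>0$, $\beta_j>0$, $\mu_{ij}\ge 0$ ($\mu_{ij}=0$ means pool $j$ cannot serve type $i$). Static planning problem (SPP): minimize $\rho$ over $(\lambda_{ij}),\rho$ subject to $\lambda_{ij}\ge0$, $\sum_j\lambda_{ij}=\lambda_i$ for all $i$, and $\sum_i\lambda_{ij}/(\beta_j\mu_{ij})\le\rho$ for all $j$. Standing assumption (complete resource pooling): the SPP has a unique optimal solution $(\lambda_{ij}),\rho$, and the set of basic activities $\mathcal E=\{(ij):\lambda_{ij}>0\}$ is the edge set of a (connected) tree on the vertex set $\mathcal I\cup\mathcal J$. $\mathcal S(i)=\{j:(ij)\in\mathcal E\}$, $\mathcal C(j)=\{i:(ij)\in\mathcal E\}$. Matrix $A_u$. For $y\in\mathbb R^I$ let $z=My\in\mathbb R^{\mathcal E}$ be the unique solution of $\sum_{i\in\mathcal C(j)}z_{ij}=\eta\beta_j$ for all $j$ and $\sum_{j\in\mathcal S(i)}z_{ij}=y_i$ for all $i$, where $\eta=\sum_iy_i/\sum_j\beta_j$. $A_u$ is the $I\times I$ matrix of the linear map $y\mapsto\big(-\sum_{j\in\mathcal S(i)}\mu_{ij}(My)_{ij}\big)_{i}$; it governs, through $(\dot\psi_i)=(\lambda_i)+A_u(\psi_i)$,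 the underloaded ($\rho<1$) fluid model near its equilibrium point. $A_u$ is stable if all its eigenvalues have negative real part; local stability of the (underloaded) system is understood as stability of $A_u$. *)

theory Defs
  imports "HOL-Analysis.Analysis"
begin

text \<open>Customer types and server pools are the elements of two finite types 'i and 'j.\<close>

section \<open>Static planning problem\<close>

text \<open>The condition for \<open>\<mu> i j = 0\<close> is the convention that a positive flow cannot be routed through a
  zero service rate (infinite load); it is needed explicitly because division by zero gives zero
  in HOL.\<close>

definition spp_feasible ::
  "('i::finite \<Rightarrow> real) \<Rightarrow> ('j::finite \<Rightarrow> real) \<Rightarrow> ('i \<Rightarrow> 'j \<Rightarrow> real)
    \<Rightarrow> ('i \<Rightarrow> 'j \<Rightarrow> real) \<Rightarrow> real \<Rightarrow> bool" where
  "spp_feasible lam \<beta> \<mu> x \<rho> \<longleftrightarrow>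
     (\<forall>i j. 0 \<le> x i j) \<and>
     (\<forall>i j. \<mu> i j = 0 \<longrightarrow> x i j = 0) \<and>
     (\<forall>i. (\<Sum>j\<in>UNIV. x i j) = lam i) \<and>
     (\<forall>j. (\<Sum>i\<in>UNIV. x i j / (\<beta> j * \<mu> i j)) \<le> \<rho>)"

definition spp_optimal ::
  "('i::finite \<Rightarrow> real) \<Rightarrow> ('j::finite \<Rightarrow> real) \<Rightarrow> ('i \<Rightarrow> 'j \<Rightarrow> real)
    \<Rightarrow> ('i \<Rightarrow> 'j \<Rightarrow> real) \<Rightarrow> real \<Rightarrow> bool" where
  "spp_optimal lam \<beta> \<mu> x \<rho> \<longleftrightarrow>
     spp_feasible lam \<beta> \<mu> x \<rho> \<and>
     (\<forall>x' \<rho>'. spp_feasible lam \<beta> \<mu> x' \<rho>' \<longrightarrow> \<rho> \<le> \<rho>')"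

definition basic_activities :: "('i \<Rightarrow> 'j \<Rightarrow> real) \<Rightarrow> ('i \<times> 'j) set" where
  "basic_activities x = {(i, j). 0 < x i j}"

section \<open>Trees\<close>

definition adj :: "('i \<times> 'j) set \<Rightarrow> 'i + 'j \<Rightarrow> 'i + 'j \<Rightarrow> bool" where
  "adj E u v \<longleftrightarrow> (\<exists>(i, j)\<in>E. (u = Inl i \<and> v = Inr j) \<or> (u = Inr j \<and> v = Inl i))"

text \<open>A cycle is the list of its vertices, without repeating the first one at the end.\<close>

definition graph_cycle :: "('i \<times> 'j) set \<Rightarrow> ('i + 'j) list \<Rightarrow> bool" where
  "graph_cycle E vs \<longleftrightarrow>
     3 \<le> length vs \<and> distinct vs \<and> successively (adj E) vs \<and> adj E (last vs) (hd vs)"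

definition is_tree :: "('i \<times> 'j) set \<Rightarrow> bool" where
  "is_tree E \<longleftrightarrow> (\<forall>u v. (adj E)\<^sup>*\<^sup>* u v) \<and> (\<nexists>vs. graph_cycle E vs)"

section \<open>Complete resource pooling\<close>

definition complete_resource_pooling ::
  "('i::finite \<Rightarrow> real) \<Rightarrow> ('j::finite \<Rightarrow> real) \<Rightarrow> ('i \<Rightarrow> 'j \<Rightarrow> real)
    \<Rightarrow> ('i \<Rightarrow> 'j \<Rightarrow> real) \<Rightarrow> real \<Rightarrow> bool" where
  "complete_resource_pooling lam \<beta> \<mu> x \<rho> \<longleftrightarrow>
     spp_optimal lam \<beta> \<mu> x \<rho> \<and>
     (\<forall>x' \<rho>'. spp_optimal lam \<beta> \<mu> x' \<rho>' \<longrightarrow> x' = x \<and> \<rho>' = \<rho>) \<and>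
     is_tree (basic_activities x)"

section \<open>The matrix of the underloaded fluid model\<close>

definition pools_of :: "('i \<times> 'j) set \<Rightarrow> 'i \<Rightarrow> 'j set" where
  "pools_of E i = {j. (i, j) \<in> E}"

definition types_of :: "('i \<times> 'j) set \<Rightarrow> 'j \<Rightarrow> 'i set" where
  "types_of E j = {i. (i, j) \<in> E}"

text \<open>A vector indexed by the edge set \<open>E\<close> is a function on all pairs that vanishes off \<open>E\<close>.\<close>

definition M_solution ::
  "('i::finite \<times> 'j::finite) set \<Rightarrow> ('j \<Rightarrow> real) \<Rightarrow> real^'i \<Rightarrow> ('i \<Rightarrow> 'j \<Rightarrow> real) \<Rightarrow> bool" where
  "M_solution E \<beta> y z \<longleftrightarrow>
     (let \<eta> = (\<Sum>i\<in>UNIV. y $ i) / (\<Sum>j\<in>UNIV. \<beta> j) in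
       (\<forall>i j. (i, j) \<notin> E \<longrightarrow> z i j = 0) \<and>
       (\<forall>j. (\<Sum>i\<in>types_of E j. z i j) = \<eta> * \<beta> j) \<and>
       (\<forall>i. (\<Sum>j\<in>pools_of E i. z i j) = y $ i))"

definition M_map ::
  "('i::finite \<times> 'j::finite) set \<Rightarrow> ('j \<Rightarrow> real) \<Rightarrow> real^'i \<Rightarrow> 'i \<Rightarrow> 'j \<Rightarrow> real" where
  "M_map E \<beta> y = (THE z. M_solution E \<beta> y z)"

definition A_u ::
  "('i::finite \<times> 'j::finite) set \<Rightarrow> ('j \<Rightarrow> real) \<Rightarrow> ('i \<Rightarrow> 'j \<Rightarrow> real) \<Rightarrow> real^'i^'i" where
  "A_u E \<beta> \<mu> = matrix (\<lambda>y. \<chi> i. - (\<Sum>j\<in>pools_of E i. \<mu> i j * M_map E \<beta> y i j))"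

section \<open>Stability\<close>

definition complex_eigenvalue :: "real^'n^'n \<Rightarrow> complex \<Rightarrow> bool" where
  "complex_eigenvalue A c \<longleftrightarrow>
     (\<exists>v::complex^'n. v \<noteq> 0 \<and> map_matrix complex_of_real A *v v = c *s v)"

definition stable_matrix :: "real^'n^'n \<Rightarrow> bool" where
  "stable_matrix A \<longleftrightarrow> (\<forall>c. complex_eigenvalue A c \<longrightarrow> Re c < 0)"

end

theory Submission
  imports Defs
begin

text \<open>
  On \<open>E\<close> the rates depend on the customer type only, so the row-sum condition on \<open>z = M y\<close> turns
  \<open>\<Sum>\<^sub>j \<mu>\<^sub>i\<^sub>j z\<^sub>i\<^sub>j\<close> into \<open>m\<^sub>i y\<^sub>i\<close>, and \<open>A_u\<close> is the diagonal matrix with entries \<open>- m\<^sub>i\<close>. This needs \<open>M y\<close> to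
  be well defined. Existence follows from connectedness, by superposing unit flows along paths.
  Uniqueness does not need acyclicity: if \<open>z\<close> is supported on \<open>E\<close> and all its marginals vanish, then
  \<open>w\<^sub>i\<^sub>j = m\<^sub>i z\<^sub>i\<^sub>j\<close> has zero row sums and zero loads, so \<open>x + \<epsilon> w\<close> is another optimal solution of the
  static planning problem unless \<open>z = 0\<close>.
\<close>

lemma sum_if_pair:
  fixes c :: real
  shows "(\<Sum>j\<in>UNIV. if i = a \<and> j = (b::'j::finite) then c else 0) = (if i = a then c else 0)"
    and "(\<Sum>i\<in>UNIV. if i = (a::'i::finite) \<and> j' = b' then c else 0) = (if j' = b' then c else 0)"
  by (cases "i = a"; simp) (cases "j' = b'"; simp)

text \<open>The column sums carry the opposite sign because flow values alternate in sign along a path of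
  the bipartite graph.\<close>

lemma unit_flow_exists:
  fixes E :: "('i::finite \<times> 'j::finite) set"
  assumes "(adj E)\<^sup>*\<^sup>* u v"
  shows "\<exists>z::'i \<Rightarrow> 'j \<Rightarrow> real. (\<forall>i j. (i, j) \<notin> E \<longrightarrow> z i j = 0) \<and>
    (\<forall>i. (\<Sum>j\<in>UNIV. z i j) = of_bool (Inl i = u) - of_bool (Inl i = v)) \<and>
    (\<forall>j. (\<Sum>i\<in>UNIV. z i j) = of_bool (Inr j = v) - of_bool (Inr j = u))"
  using assms
proof (induction rule: rtranclp_induct)
  case base
  show ?case by (rule exI[of _ "\<lambda>_ _. 0"]) simp
next
  case (step v w)
  then obtain z :: "'i \<Rightarrow> 'j \<Rightarrow> real" where z: "\<And>i j. (i, j) \<notin> E \<Longrightarrow> z i j = 0"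
    "\<And>i. (\<Sum>j\<in>UNIV. z i j) = of_bool (Inl i = u) - of_bool (Inl i = v)"
    "\<And>j. (\<Sum>i\<in>UNIV. z i j) = of_bool (Inr j = v) - of_bool (Inr j = u)"
    by blast
  from step.hyps(2) obtain a b where ab: "(a, b) \<in> E"
    "v = Inl a \<and> w = Inr b \<or> v = Inr b \<and> w = Inl a"
    by (auto simp: adj_def)
  \<comment> \<open>The new edge carries +1 when crossed from type to pool and -1 when crossed back.
    In both directions this cancels the marginal at the old endpoint \<open>v\<close> and leaves the
    matching one at \<open>w\<close>.\<close>
  define c :: real where "c = (if v = Inl a then 1 else - 1)"
  show ?case
  proof (intro exI conjI allI impI)
    show "z i j + (if i = a \<and> j = b then c else 0) = 0" if "(i, j) \<notin> E" for i j
      using that ab z(1) by auto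
    show "(\<Sum>j\<in>UNIV. z i j + (if i = a \<and> j = b then c else 0)) =
        of_bool (Inl i = u) - of_bool (Inl i = w)" for i
      using ab(2) by (auto simp: sum.distrib z(2) sum_if_pair c_def)
    show "(\<Sum>i\<in>UNIV. z i j + (if i = a \<and> j = b then c else 0)) =
        of_bool (Inr j = w) - of_bool (Inr j = u)" for j
      using ab(2) by (auto simp: sum.distrib z(3) sum_if_pair c_def)
  qed
qed

lemma sum_weighted_unit_flows:
  fixes p :: "'k::finite \<Rightarrow> real"
  shows "(\<Sum>j\<in>A. \<Sum>k\<in>UNIV. p k * f k j) = (\<Sum>k\<in>UNIV. p k * (\<Sum>j\<in>A. f k j))"
  by (subst sum.swap) (simp add: sum_distrib_left)

text \<open>Every vertex is joined to a common root by a unit flow, and these flows are superposed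
  with the prescribed marginals as weights. Only the marginal at the root can come out wrong, and
  the balance condition makes its error vanish.\<close>

lemma connected_transport_exists:
  fixes E :: "('i::finite \<times> 'j::finite) set" and p :: "'i \<Rightarrow> real" and q :: "'j \<Rightarrow> real"
  assumes conn: "\<And>u v. (adj E)\<^sup>*\<^sup>* u v"
    and bal: "(\<Sum>i\<in>UNIV. p i) = (\<Sum>j\<in>UNIV. q j)"
  obtains z :: "'i \<Rightarrow> 'j \<Rightarrow> real" where "\<And>i j. (i, j) \<notin> E \<Longrightarrow> z i j = 0"
    "\<And>i. (\<Sum>j\<in>UNIV. z i j) = p i" "\<And>j. (\<Sum>i\<in>UNIV. z i j) = q j"
proof -
  \<comment> \<open>An arbitrary type vertex serves as root, so the column sums contain no root
    term.\<close>
  define r :: "'i + 'j" where "r = Inl undefined"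
  obtain f :: "'i + 'j \<Rightarrow> 'i \<Rightarrow> 'j \<Rightarrow> real" where f: "\<And>u i j. (i, j) \<notin> E \<Longrightarrow> f u i j = 0"
    "\<And>u i. (\<Sum>j\<in>UNIV. f u i j) = of_bool (Inl i = u) - of_bool (Inl i = r)"
    "\<And>u j. (\<Sum>i\<in>UNIV. f u i j) = of_bool (Inr j = r) - of_bool (Inr j = u)"
    using unit_flow_exists[OF conn[of _ r]] by metis
  show ?thesis
  proof
    \<comment> \<open>The flows from pools enter with a minus sign because the column sum of
      \<open>f (Inr l)\<close> at its own pool is -1. At the root the two sums contribute minus the
      total of \<open>p\<close> plus the total of \<open>q\<close>.\<close>
    show "(\<Sum>k\<in>UNIV. p k * f (Inl k) i j) - (\<Sum>l\<in>UNIV. q l * f (Inr l) i j) = 0"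
      if "(i, j) \<notin> E" for i j
      using f(1)[OF that] by simp
    show "(\<Sum>j\<in>UNIV. (\<Sum>k\<in>UNIV. p k * f (Inl k) i j) - (\<Sum>l\<in>UNIV. q l * f (Inr l) i j)) = p i"
      for i
      by (simp add: sum_subtractf sum_weighted_unit_flows f(2) right_diff_distrib bal sum_negf
          flip: sum_distrib_right)
    show "(\<Sum>i\<in>UNIV. (\<Sum>k\<in>UNIV. p k * f (Inl k) i j) - (\<Sum>l\<in>UNIV. q l * f (Inr l) i j)) = q j"
      for j
      by (simp add: sum_subtractf sum_weighted_unit_flows f(3) right_diff_distrib bal
          flip: sum_distrib_right)
  qed
qed

lemma M_solution_iff:
  fixes E :: "('i::finite \<times> 'j::finite) set"
  shows "M_solution E \<beta> y z \<longleftrightarrow>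
    (\<forall>i j. (i, j) \<notin> E \<longrightarrow> z i j = 0) \<and>
    (\<forall>j. (\<Sum>i\<in>UNIV. z i j) = (\<Sum>i\<in>UNIV. y $ i) / (\<Sum>j\<in>UNIV. \<beta> j) * \<beta> j) \<and>
    (\<forall>i. (\<Sum>j\<in>UNIV. z i j) = y $ i)"
proof -
  have "(\<Sum>i\<in>types_of E j. z i j) = (\<Sum>i\<in>UNIV. z i j)"
    if "\<forall>i j. (i, j) \<notin> E \<longrightarrow> z i j = 0" for j
    using that by (intro sum.mono_neutral_left) (auto simp: types_of_def)
  moreover have "(\<Sum>j\<in>pools_of E i. z i j) = (\<Sum>j\<in>UNIV. z i j)"
    if "\<forall>i j. (i, j) \<notin> E \<longrightarrow> z i j = 0" for i
    using that by (intro sum.mono_neutral_left) (auto simp: pools_of_def)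
  ultimately show ?thesis
    by (auto simp: M_solution_def)
qed

lemma M_solution_exists:
  fixes E :: "('i::finite \<times> 'j::finite) set" and \<beta> :: "'j \<Rightarrow> real"
  assumes "is_tree E" and "\<And>j. 0 < \<beta> j"
  shows "\<exists>z. M_solution E \<beta> y z"
proof -
  have "0 < (\<Sum>j\<in>UNIV. \<beta> j)"
    using assms(2) by (intro sum_pos) auto
  \<comment> \<open>The factor \<eta> is exactly the one that equates total supply and total
    demand.\<close>
  then have bal: "(\<Sum>i\<in>UNIV. y $ i) = (\<Sum>j\<in>UNIV. (\<Sum>i\<in>UNIV. y $ i) / (\<Sum>j\<in>UNIV. \<beta> j) * \<beta> j)"
    unfolding sum_distrib_left[symmetric] by simp
  have conn: "(adj E)\<^sup>*\<^sup>* u v" for u v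
    using assms(1) by (simp add: is_tree_def)
  obtain z :: "'i \<Rightarrow> 'j \<Rightarrow> real" where "\<And>i j. (i, j) \<notin> E \<Longrightarrow> z i j = 0"
    "\<And>i. (\<Sum>j\<in>UNIV. z i j) = y $ i"
    "\<And>j. (\<Sum>i\<in>UNIV. z i j) = (\<Sum>i\<in>UNIV. y $ i) / (\<Sum>j\<in>UNIV. \<beta> j) * \<beta> j"
    using connected_transport_exists[OF conn bal] by blast
  then show ?thesis
    unfolding M_solution_iff by blast
qed

text \<open>Zero coordinates do not move, and positive ones stay positive for small \<open>e\<close>
  by continuity. Finitely many coordinates allow a common \<open>e\<close>.\<close>

lemma ex_small_perturbation:
  fixes x w :: "'k::finite \<Rightarrow> real"
  assumes "\<And>k. 0 \<le> x k" and "\<And>k. x k = 0 \<Longrightarrow> w k = 0"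
  obtains e where "0 < e" "\<And>k. 0 \<le> x k + e * w k"
proof -
  have "\<forall>\<^sub>F e in at_right 0. 0 \<le> x k + e * w k" for k
  proof (cases "x k = 0")
    case True
    then show ?thesis using assms(2) by simp
  next
    case False
    have "((\<lambda>e. x k + e * w k) \<longlongrightarrow> x k + 0 * w k) (at_right 0)"
      by (intro tendsto_intros)
    moreover have "0 < x k + 0 * w k"
      using False assms(1)[of k] by simp
    ultimately have "\<forall>\<^sub>F e in at_right 0. 0 < x k + e * w k"
      by (rule order_tendstoD(1))
    then show ?thesis by (rule eventually_mono) simp
  qed
  then have "\<forall>\<^sub>F e in at_right 0. \<forall>k. 0 \<le> x k + e * w k"
    by (simp add: eventually_all_finite)
  moreover have "\<forall>\<^sub>F e in at_right 0. (0::real) < e"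
    by (simp add: eventually_at_right_less)
  ultimately have "\<forall>\<^sub>F e in at_right 0. (0::real) < e \<and> (\<forall>k. 0 \<le> x k + e * w k)"
    by eventually_elim simp
  then show ?thesis
    using that by (auto dest!: eventually_happens)
qed

lemma spp_unique_imp_no_circulation:
  fixes lam m :: "'i::finite \<Rightarrow> real" and \<beta> :: "'j::finite \<Rightarrow> real"
    and \<mu> x z :: "'i \<Rightarrow> 'j \<Rightarrow> real"
  assumes opt: "spp_optimal lam \<beta> \<mu> x \<rho>"
    and uniq: "\<And>x' \<rho>'. spp_optimal lam \<beta> \<mu> x' \<rho>' \<Longrightarrow> x' = x"
    and m: "\<And>i. 0 < m i" "\<And>i j. (i, j) \<in> basic_activities x \<Longrightarrow> \<mu> i j = m i"
    and z: "\<And>i j. (i, j) \<notin> basic_activities x \<Longrightarrow> z i j = 0"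
    and row: "\<And>i. (\<Sum>j\<in>UNIV. z i j) = 0" and col: "\<And>j. (\<Sum>i\<in>UNIV. z i j) = 0"
  shows "z i j = 0"
proof -
  have feas: "0 \<le> x i j" "\<mu> i j = 0 \<Longrightarrow> x i j = 0" "(\<Sum>j\<in>UNIV. x i j) = lam i"
    "(\<Sum>i\<in>UNIV. x i j / (\<beta> j * \<mu> i j)) \<le> \<rho>" for i j
    using opt by (auto simp: spp_optimal_def spp_feasible_def)
  \<comment> \<open>Zero entries of \<open>x\<close> stay zero under the perturbation, which
    preserves both nonnegativity and the convention for vanishing rates.\<close>
  have z0: "z i j = 0" if "x i j = 0" for i j
    using that z by (simp add: basic_activities_def)
  obtain e where "0 < e" and "\<And>k. 0 \<le> x (fst k) (snd k) + e * (m (fst k) * z (fst k) (snd k))"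
    using ex_small_perturbation[of "\<lambda>k. x (fst k) (snd k)" "\<lambda>k. m (fst k) * z (fst k) (snd k)"]
      feas(1) z0 by auto
  then have e: "0 < e" "\<And>i j. 0 \<le> x i j + e * (m i * z i j)"
    by (metis fst_conv snd_conv)+
  let ?x' = "\<lambda>i j. x i j + e * (m i * z i j)"
  \<comment> \<open>On a basic activity the factor \<open>m i\<close> cancels against the service
    rate, so the change in load is proportional to \<open>z i j\<close> with a factor depending on
    \<open>j\<close> only. Summing over \<open>i\<close> then gives a multiple of a zero column
    sum.\<close>
  have load: "?x' i j / (\<beta> j * \<mu> i j) = x i j / (\<beta> j * \<mu> i j) + e / \<beta> j * z i j" for i j
  proof (cases "(i, j) \<in> basic_activities x")
    case True
    with m[of i] show ?thesis by (simp add: add_divide_distrib)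
  next
    case False
    then show ?thesis by (simp add: z)
  qed
  have "(\<Sum>i\<in>UNIV. ?x' i j / (\<beta> j * \<mu> i j)) = (\<Sum>i\<in>UNIV. x i j / (\<beta> j * \<mu> i j))" for j
    unfolding load sum.distrib sum_distrib_left[symmetric] col by simp
  moreover have "(\<Sum>j\<in>UNIV. ?x' i j) = (\<Sum>j\<in>UNIV. x i j)" for i
    unfolding sum.distrib sum_distrib_left[symmetric] row by simp
  ultimately have "spp_feasible lam \<beta> \<mu> ?x' \<rho>"
    unfolding spp_feasible_def using e(2) feas z0 by simp
  \<comment> \<open>The perturbed flow is feasible at the same, already minimal value
    \<rho>.\<close>
  then have "spp_optimal lam \<beta> \<mu> ?x' \<rho>"
    using opt by (simp add: spp_optimal_def)
  then have "?x' = x"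
    by (rule uniq)
  then have "?x' i j = x i j"
    by (rule fun_cong[OF fun_cong])
  then show ?thesis
    using e(1) m(1)[of i] by simp
qed

lemma M_solution_unique:
  fixes lam m :: "'i::finite \<Rightarrow> real" and \<beta> :: "'j::finite \<Rightarrow> real"
    and \<mu> x z z' :: "'i \<Rightarrow> 'j \<Rightarrow> real"
  assumes "spp_optimal lam \<beta> \<mu> x \<rho>"
    and "\<And>x' \<rho>'. spp_optimal lam \<beta> \<mu> x' \<rho>' \<Longrightarrow> x' = x"
    and "\<And>i. 0 < m i" "\<And>i j. (i, j) \<in> basic_activities x \<Longrightarrow> \<mu> i j = m i"
    and "M_solution (basic_activities x) \<beta> y z" "M_solution (basic_activities x) \<beta> y z'"
  shows "z = z'"
proof (intro ext)
  fix i j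
  have "z i j - z' i j = 0"
  proof (rule spp_unique_imp_no_circulation[OF assms(1-4), where z = "\<lambda>i j. z i j - z' i j"])
    show "z i j - z' i j = 0" if "(i, j) \<notin> basic_activities x" for i j
      using that assms(5,6) by (simp add: M_solution_iff)
    show "(\<Sum>j\<in>UNIV. z i j - z' i j) = 0" "(\<Sum>i\<in>UNIV. z i j - z' i j) = 0" for i j
      using assms(5,6) by (simp_all add: M_solution_iff sum_subtractf)
  qed
  then show "z i j = z' i j" by simp
qed

lemma A_u_eq_diagonal:
  fixes lam m :: "'i::finite \<Rightarrow> real" and \<beta> :: "'j::finite \<Rightarrow> real"
    and \<mu> x :: "'i \<Rightarrow> 'j \<Rightarrow> real"
  assumes crp: "complete_resource_pooling lam \<beta> \<mu> x \<rho>"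
    and "\<And>j. 0 < \<beta> j"
    and m: "\<And>i. 0 < m i" "\<And>i j. (i, j) \<in> basic_activities x \<Longrightarrow> \<mu> i j = m i"
  shows "A_u (basic_activities x) \<beta> \<mu> = (\<chi> i k. if i = k then - m i else 0)"
proof -
  let ?E = "basic_activities x"
  have opt: "spp_optimal lam \<beta> \<mu> x \<rho>"
    and uniq: "\<And>x' \<rho>'. spp_optimal lam \<beta> \<mu> x' \<rho>' \<Longrightarrow> x' = x"
    and tree: "is_tree ?E"
    using crp unfolding complete_resource_pooling_def by blast+
  have "M_solution ?E \<beta> y (M_map ?E \<beta> y)" for y
  proof -
    obtain z where z: "M_solution ?E \<beta> y z"
      using M_solution_exists[OF tree, of \<beta> y] assms(2) by blast
    then show ?thesis
      unfolding M_map_def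
      by (rule theI[where P = "M_solution ?E \<beta> y"]) (rule M_solution_unique[OF opt uniq m _ z])
  qed
  then have "(\<Sum>j\<in>pools_of ?E i. \<mu> i j * M_map ?E \<beta> y i j) = m i * y $ i" for i y
    using m(2) by (simp add: pools_of_def M_solution_def Let_def flip: sum_distrib_left)
  \<comment> \<open>\<open>matrix\<close> reads its columns off at the unit vectors, where the
    formula just obtained gives every entry.\<close>
  then show ?thesis
    by (simp add: A_u_def matrix_def vec_eq_iff axis_def)
qed

lemma stable_matrix_diagonal:
  fixes d :: "'n::finite \<Rightarrow> real"
  assumes "\<And>i. d i < 0"
  shows "stable_matrix (\<chi> i k. if i = k then d i else 0)"
  unfolding stable_matrix_def complex_eigenvalue_def
proof (intro allI impI, elim exE conjE)
  fix c and v :: "complex^'n"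
  assume v: "v \<noteq> 0"
    and eig: "map_matrix complex_of_real (\<chi> i k. if i = k then d i else 0) *v v = c *s v"
  \<comment> \<open>At a nonzero coordinate of the eigenvector, the eigenvalue equation forces
    \<open>c\<close> to be the diagonal entry there.\<close>
  from v obtain i where i: "v $ i \<noteq> 0"
    by (auto simp: vec_eq_iff)
  have "(map_matrix complex_of_real (\<chi> i k. if i = k then d i else 0) *v v) $ i =
      (\<Sum>k\<in>UNIV. if i = k then complex_of_real (d i) * v $ k else 0)"
    unfolding matrix_vector_mult_def map_matrix_def vec_lambda_beta by (rule sum.cong) auto
  then have "complex_of_real (d i) * v $ i = c * v $ i"
    by (auto simp: eig)
  with i have "c = complex_of_real (d i)" by simp
  with assms show "Re c < 0" by simp
qed

theorem theorem4p2:
  fixes lam :: "'i::finite \<Rightarrow> real"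
    and \<beta> :: "'j::finite \<Rightarrow> real"
    and \<mu> x :: "'i \<Rightarrow> 'j \<Rightarrow> real"
    and \<rho> :: real
  assumes "\<forall>i. 0 < lam i"
    and "\<forall>j. 0 < \<beta> j"
    and "\<forall>i j. 0 \<le> \<mu> i j"
    and "complete_resource_pooling lam \<beta> \<mu> x \<rho>"
    and "\<rho> < 1"
    and "\<exists>m :: 'i \<Rightarrow> real. (\<forall>i. 0 < m i) \<and> (\<forall>(i, j) \<in> basic_activities x. \<mu> i j = m i)"
  shows "stable_matrix (A_u (basic_activities x) \<beta> \<mu>)"
proof -
  from assms(6) obtain m :: "'i \<Rightarrow> real" where m: "\<And>i. 0 < m i"
    "\<And>i j. (i, j) \<in> basic_activities x \<Longrightarrow> \<mu> i j = m i"
    by blast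
  have "A_u (basic_activities x) \<beta> \<mu> = (\<chi> i k. if i = k then - m i else 0)"
    using assms(2) by (intro A_u_eq_diagonal[OF assms(4) _ m]) auto
  then show ?thesis
    using stable_matrix_diagonal[of "\<lambda>i. - m i"] m(1) by simp
qed

end
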